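(* Let $\mathbf q^\ell(t)$ be a solution of the semi-discrete finite volume scheme (S) written out in the context, with the production term $\Pi^{\ell r,-}_{\mathbf n}$ given there. Assume $T^\ell>0$ and $\boldsymbol{\mathcal H}^{\ell r}=\partial^2_{\mathbf q\mathbf q}\mathcal E^{\ell r}\ge0$ (positive semi-definite). Then the scheme satisfies the semi-discrete cell entropy inequality $$\frac{\partial(\rho S)^\ell}{\partial t}+\sum_{r\in N_\ell}\frac{|\partial\Omega^{\ell r}|}{|\Omega^\ell|}D_{\rho S}^{\ell r,-}+\sum_{r\in N_\ell}\frac{|\partial\Omega^{\ell r}|}{|\Omega^\ell|}\big(\beta_k^{\ell r}-\beta_k^\ell\big)n_k-\sum_{r\in N_\ell}\frac{|\partial\Omega^{\ell r}|}{|\Omega^\ell|}g_{\rho S,\mathbf n}^{\ell r}\ \ge\ 0 .$$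
   Context: **Conventions.** Tensor indices $i,j,k,m$ range over $\{1,2,3\}$ and repeated tensor indices are summed. Superscripts $\ell,r$ label cells and are never summed implicitly. Constants: $\gamma>1$, $c_v,c_s,c_h,\rho_0,T_0,\tau_1,\tau_2>0$. **States and energy.** The state vector is $\mathbf q=(\rho,\rho v_i,\rho S,A_{ik},J_k)$, taken with $\rho>0$ and $|A|=\det A>0$ so that all expressions below are defined. The total energy potential, a function of $\mathbf q$, is $\mathcal E=\mathcal E_1+\mathcal E_2+\mathcal E_3+\mathcal E_4$ with $$\mathcal E_1=\frac{\rho^\gamma}{\gamma-1}e^{S/c_v},\quad \mathcal E_2=\tfrac12\rho v_iv_i,\quad \mathcal E_3=\tfrac14\rho c_s^2\mathring G_{ij}\mathring G_{ij},\quad \mathcal E_4=\tfrac12c_h^2\rho J_iJ_i,$$ where $G_{ik}=A_{ji}A_{jk}$ and $\mathring G_{ik}=G_{ik}-\frac13G_{mm}\delta_{ik}$. Write $E_3=\mathcal E_3/\rho$ and $E_4=\mathcal E_4/\rho$. Partial derivatives of the energies are with respect to the independent variables $\rho,\rho v_i,\rho S,A_{ik},J_k$. The dual variables are $\mathbf p=\partial_{\mathbf q}\mathcal E=(\partial_\rho\mathcal E,\,v_i,\,T,\,\alpha_{ik},\,\beta_k)$ with $v_i=\partial_{\rho v_i}\mathcal E$, $T=\partial_{\rho S}\mathcal E=\frac{\rho^{\gamma-1}}{(\gamma-1)c_v}e^{S/c_v}$, $\alpha_{ik}=\partial_{A_{ik}}\mathcal E$, $\beta_k=\partial_{J_k}\mathcal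 E$. The pressure is $p=\rho\,\partial_\rho\mathcal E+\rho v_i\,\partial_{\rho v_i}\mathcal E+\rho S\,\partial_{\rho S}\mathcal E-\mathcal E$. The stresses are $\sigma_{ik}=A_{ji}\alpha_{jk}$ and $\omega_{ik}=J_i\beta_k$. Relaxation functions: $\theta_1=\frac13\rho z_1\tau_1c_s^2|A|^{-5/3}>0$, $\theta_2=\rho z_2\tau_2c_h^2>0$, $z_1=\rho_0/\rho$, $z_2=\rho_0T_0/(\rho T)$. A superscript $\ell$ on any such quantity means evaluation at $\mathbf q^\ell$. **Mesh.** The two-dimensional domain $\Omega$ is divided into control volumes $\Omega^\ell$ with circumcenters $\mathbf x^\ell$, forming a Cartesian grid with mesh spacings $\Delta x,\Delta y$. $N_\ell$ is the set of neighbors of $\Omega^\ell$ and $\partial\Omega^{\ell r}$ is the common edge of $\Omega^\ell$ and its neighbor $\Omega^r$. The unit normal to this edge, outward from $\Omega^\ell$, is $\mathbf n=\mathbf n^{\ell r}=(n_1,n_2)$ (with $n_3=0$ in sums over $k$). Set $\delta^{\ell r}=\|\mathbf x^r-\mathbf x^\ell\|=\Delta x\,|n_1|+\Delta y\,|n_2|$. For an edge on $\partial\Omega$ the exterior side, carrying a boundary state, plays the role of the neighbor. The numerical viscosities satisfy $\epsilon^{\ell r}=\epsilon^{r\ell}\ge0$. **Numerical flux of the Euler part.** Let $\mathbf w=(\partial_\rho(\mathcal E_1+\mathcal E_2),v_1,v_2,v_3,T)$ be the dual variables of the Euler subsystem; the map $(\rho,\rho v_i,\rho S)\mapsto\mathbf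 w$ is a bijection from $\{\rho>0\}$ onto $\{T>0\}$. Let $f_k=(f_{\rho,k},f_{\rho v_i,k},f_{\rho S,k})=(\rho v_k,\ \rho v_iv_k+p\,\delta_{ik},\ \rho Sv_k)$, regarded as a function of $\mathbf w$. Define $$f_k^{\ell r}=\int_0^1 f_k\big(\mathbf w^\ell+s(\mathbf w^r-\mathbf w^\ell)\big)\,ds,\qquad D^{\ell r,-}_{\bullet}=\big(f^{\ell r}_{\bullet,k}-f^\ell_{\bullet,k}\big)n_k\quad(\bullet=\rho,\rho v_i,\rho S).$$ **Other face quantities.** Put $\Delta\mathbf q^{\ell r}=\mathbf q^r-\mathbf q^\ell$ and $$\mathbf g^{\ell r}_{\mathbf n}=\epsilon^{\ell r}\frac{\Delta\mathbf q^{\ell r}}{\delta^{\ell r}}\ \text{ with components } g^{\ell r}_{\rho,\mathbf n},\,g^{\ell r}_{\rho v_i,\mathbf n},\,g^{\ell r}_{\rho S,\mathbf n},\,g^{\ell r}_{A_{ik},\mathbf n},\,g^{\ell r}_{J_k,\mathbf n},$$ $$A^{\ell r}_{im}=\tfrac12(A^\ell_{im}+A^r_{im}),\quad J_m^{\ell r}=\tfrac12(J^\ell_m+J^r_m),\quad \beta_k^{\ell r}=\tfrac12(\beta_k^\ell+\beta_k^r),\quad T^{\ell r,-}=T^r-T^\ell,$$ $$\sigma_{jk}^{\ell r}=\tfrac12A_{ij}^{\ell r}(\alpha_{ik}^\ell+\alpha_{ik}^r),\quad \sigma_{jk}^{\ell r,-}=\sigma_{jk}^{\ell r}-\sigma_{jk}^\ell,\quad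 \omega_{jk}^{\ell r}=\tfrac12(\beta_k^\ell+\beta_k^r)J_j^{\ell r},\quad \omega_{jk}^{\ell r,-}=\omega^{\ell r}_{jk}-\omega^\ell_{jk},$$ $$\tilde u^{\ell r}_{A,\mathbf n}=\frac{f^{\ell r}_{\rho,j}n_j\,(E_3^r-E_3^\ell)}{\frac12(\alpha_{ik}^\ell+\alpha_{ik}^r)(A_{ik}^r-A_{ik}^\ell)},\qquad \tilde u^{\ell r}_{J,\mathbf n}=\frac{f^{\ell r}_{\rho,j}n_j\,(E_4^r-E_4^\ell)}{\frac12(\beta_k^\ell+\beta_k^r)(J_k^r-J_k^\ell)}$$ whenever the respective denominator is nonzero. If $E_3^r-E_3^\ell=0$ (resp. $E_4^r-E_4^\ell=0$), then $\tilde u^{\ell r}_{A,\mathbf n}=0$ (resp. $\tilde u^{\ell r}_{J,\mathbf n}=0$). If the denominator vanishes while the energy jump $E_3^r-E_3^\ell$ (resp. $E_4^r-E_4^\ell$) does not, the quotient is replaced by the normal component of the arithmetic average velocity, $\frac12(v_j^\ell+v_j^r)n_j$. The Roe-type matrix is $\boldsymbol{\mathcal H}^{\ell r}=\partial^2_{\mathbf q\mathbf q}\mathcal E^{\ell r}=\int_0^1\partial^2_{\mathbf q\mathbf q}\mathcal E(\mathbf q^\ell+s\,\Delta\mathbf q^{\ell r})\,ds$, and $$\Pi^{\ell r,-}_{\mathbf n}=\frac12\,\epsilon^{\ell r}\,\frac{\Delta\mathbf q^{\ell r}}{T^\ell}\cdot\boldsymbol{\mathcal H}^{\ell r}\,\frac{\Delta\mathbf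 q^{\ell r}}{\delta^{\ell r}} .$$ **Scheme (S).** With the abbreviation $\langle X^{\ell r}\rangle=\frac1{|\Omega^\ell|}\sum_{r\in N_\ell}|\partial\Omega^{\ell r}|X^{\ell r}$, for every cell $\ell$: $$\partial_t\rho^\ell=-\langle D_\rho^{\ell r,-}\rangle+\langle g^{\ell r}_{\rho,\mathbf n}\rangle,$$ $$\partial_t(\rho v_i)^\ell=-\langle D_{\rho v_i}^{\ell r,-}\rangle-\langle\sigma_{ik}^{\ell r,-}n_k\rangle-\langle\omega_{ik}^{\ell r,-}n_k\rangle+\langle g^{\ell r}_{\rho v_i,\mathbf n}\rangle,$$ $$\partial_t(\rho S)^\ell=-\langle D_{\rho S}^{\ell r,-}\rangle-\langle(\beta_k^{\ell r}-\beta_k^\ell)n_k\rangle+\langle g^{\ell r}_{\rho S,\mathbf n}\rangle+\langle\Pi^{\ell r,-}_{\mathbf n}\rangle+\frac{\alpha_{ik}^\ell\alpha_{ik}^\ell}{\theta_1^\ell T^\ell}+\frac{\beta_i^\ell\beta_i^\ell}{\theta_2^\ell T^\ell},$$ $$\partial_tA_{ik}^\ell=-\langle\tfrac12A_{im}^{\ell r}(v_m^r-v_m^\ell)n_k\rangle-\langle\tfrac12\tilde u^{\ell r}_{A,\mathbf n}(A_{ik}^r-A_{ik}^\ell)\rangle+\langle g^{\ell r}_{A_{ik},\mathbf n}\rangle-\frac{\alpha_{ik}^\ell}{\theta_1^\ell},$$ $$\partial_tJ_k^\ell=-\langle\tfrac12J_m^{\ell r}(v_m^r-v_m^\ell)n_k\rangle-\langle\tfrac12T^{\ell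 r,-}n_k\rangle-\langle\tfrac12\tilde u^{\ell r}_{J,\mathbf n}(J_k^r-J_k^\ell)\rangle+\langle g^{\ell r}_{J_k,\mathbf n}\rangle-\frac{\beta_k^\ell}{\theta_2^\ell}.$$ *)

theory Defs
  imports "HOL-Analysis.Analysis"
begin

section \<open>Partial derivatives on coordinate spaces\<close>

definition partial :: "'n::finite \<Rightarrow> (real^'n \<Rightarrow> real) \<Rightarrow> real^'n \<Rightarrow> real" where
  "partial i f x = deriv (\<lambda>h. f (x + h *\<^sub>R axis i 1)) 0"

definition grad :: "(real^'n::finite \<Rightarrow> real) \<Rightarrow> real^'n \<Rightarrow> real^'n" where
  "grad f x = (\<chi> i. partial i f x)"

definition hessian :: "(real^'n::finite \<Rightarrow> real) \<Rightarrow> real^'n \<Rightarrow> real^'n^'n" where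
  "hessian f x = (\<chi> i j. partial i (partial j f) x)"

text \<open>Symmetry is not part of the definition; it is automatic for the averaged Hessians
  of the (smooth) energy to which the notion is applied.\<close>

definition pos_semidef :: "real^'n^'n::finite \<Rightarrow> bool" where
  "pos_semidef M \<longleftrightarrow> (\<forall>x. 0 \<le> x \<bullet> (M *v x))"


section \<open>States\<close>

text \<open>Labels of the independent (conserved) variables: \<open>Rho\<close>, \<open>Mom i\<close>, \<open>Ent\<close> stand for
  $\rho$, $\rho v_i$, $\rho S$, and \<open>Dst i k\<close>, \<open>Thm k\<close> for $A_{ik}$, $J_k$. In particular the
  coordinates are $\rho v_i$ and $\rho S$, not $v_i$ and $S$.\<close>

datatype euler_comp = Rho | Mom "3" | Ent

datatype comp = Eul euler_comp | Dst "3" "3" | Thm "3"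

instance euler_comp :: finite
proof
  have "(UNIV :: euler_comp set) = {Rho, Ent} \<union> range Mom"
    by (auto intro: euler_comp.exhaust)
  then show "finite (UNIV :: euler_comp set)" by (metis finite.emptyI finite.insertI finite_UnI finite_imageI finite)
qed

instance comp :: finite
proof
  have "(UNIV :: comp set) = range Eul \<union> range (case_prod Dst) \<union> range Thm"
  proof -
    have "x \<in> range Eul \<union> range (case_prod Dst) \<union> range Thm" for x :: comp
      by (cases x) (auto simp: image_iff)
    then show ?thesis by blast
  qed
  then show "finite (UNIV :: comp set)" by (metis finite_UnI finite_imageI finite)
qed

type_synonym euler_state = "real^euler_comp"
type_synonym state = "real^comp"

definition eul :: "state \<Rightarrow> euler_state" where "eul q = (\<chi> c. q $ Eul c)"
definition dens :: "state \<Rightarrow> real" where "dens q = q $ Eul Rho"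
definition dist_mat :: "state \<Rightarrow> real^3^3" where "dist_mat q = (\<chi> i k. q $ Dst i k)"
definition thermal :: "state \<Rightarrow> real^3" where "thermal q = (\<chi> k. q $ Thm k)"
definition vel :: "state \<Rightarrow> real^3" where "vel q = (\<chi> i. q $ Eul (Mom i) / q $ Eul Rho)"

definition admissible :: "state \<Rightarrow> bool" where
  "admissible q \<longleftrightarrow> dens q > 0 \<and> det (dist_mat q) > 0"


section \<open>Energies and dual variables\<close>

record params =
  gam :: real
  c_v :: real
  c_s :: real
  c_h :: real
  rho0 :: real
  T0 :: real
  tau1 :: real
  tau2 :: real

definition params_ok :: "params \<Rightarrow> bool" where
  "params_ok P \<longleftrightarrow> gam P > 1 \<and> c_v P > 0 \<and> c_s P > 0 \<and> c_h P > 0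
     \<and> rho0 P > 0 \<and> T0 P > 0 \<and> tau1 P > 0 \<and> tau2 P > 0"

definition energy1 :: "params \<Rightarrow> euler_state \<Rightarrow> real" where
  "energy1 P U = (U $ Rho) powr (gam P) / (gam P - 1) * exp ((U $ Ent / U $ Rho) / c_v P)"

definition energy2 :: "euler_state \<Rightarrow> real" where
  "energy2 U = 1/2 * U $ Rho * (\<Sum>i\<in>UNIV. (U $ Mom i / U $ Rho)\<^sup>2)"

definition metric :: "real^3^3 \<Rightarrow> real^3^3" where
  "metric A = transpose A ** A"

definition metric_dev :: "real^3^3 \<Rightarrow> real^3^3" where
  "metric_dev A = metric A - (trace (metric A) / 3) *\<^sub>R mat 1"

definition energy3 :: "params \<Rightarrow> state \<Rightarrow> real" where
  "energy3 P q = 1/4 * dens q * (c_s P)\<^sup>2 * (\<Sum>i\<in>UNIV. \<Sum>j\<in>UNIV. (metric_dev (dist_mat q) $ i $ j)\<^sup>2)"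

definition energy4 :: "params \<Rightarrow> state \<Rightarrow> real" where
  "energy4 P q = 1/2 * (c_h P)\<^sup>2 * dens q * (\<Sum>i\<in>UNIV. (q $ Thm i)\<^sup>2)"

definition spec_energy3 :: "params \<Rightarrow> state \<Rightarrow> real" where
  "spec_energy3 P q = energy3 P q / dens q"

definition spec_energy4 :: "params \<Rightarrow> state \<Rightarrow> real" where
  "spec_energy4 P q = energy4 P q / dens q"

definition euler_energy :: "params \<Rightarrow> euler_state \<Rightarrow> real" where
  "euler_energy P U = energy1 P U + energy2 U"

definition energy :: "params \<Rightarrow> state \<Rightarrow> real" where
  "energy P q = euler_energy P (eul q) + energy3 P q + energy4 P q"

definition dual :: "params \<Rightarrow> state \<Rightarrow> state" where
  "dual P q = grad (energy P) q"

definition temp :: "params \<Rightarrow> state \<Rightarrow> real" where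
  "temp P q = dual P q $ Eul Ent"

definition alpha :: "params \<Rightarrow> state \<Rightarrow> real^3^3" where
  "alpha P q = (\<chi> i k. dual P q $ Dst i k)"

definition beta :: "params \<Rightarrow> state \<Rightarrow> real^3" where
  "beta P q = (\<chi> k. dual P q $ Thm k)"

definition pressure :: "params \<Rightarrow> state \<Rightarrow> real" where
  "pressure P q = (\<Sum>c\<in>UNIV. q $ Eul c * dual P q $ Eul c) - energy P q"

definition stress :: "params \<Rightarrow> state \<Rightarrow> real^3^3" where
  "stress P q = (\<chi> i k. \<Sum>j\<in>UNIV. q $ Dst j i * alpha P q $ j $ k)"

definition thermal_stress :: "params \<Rightarrow> state \<Rightarrow> real^3^3" where
  "thermal_stress P q = (\<chi> i k. q $ Thm i * beta P q $ k)"

definition theta1 :: "params \<Rightarrow> state \<Rightarrow> real" where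
  "theta1 P q = 1/3 * dens q * (rho0 P / dens q) * tau1 P * (c_s P)\<^sup>2 * det (dist_mat q) powr (-5/3)"

definition theta2 :: "params \<Rightarrow> state \<Rightarrow> real" where
  "theta2 P q = dens q * (rho0 P * T0 P / (dens q * temp P q)) * tau2 P * (c_h P)\<^sup>2"


section \<open>The Euler subsystem and its numerical flux\<close>

definition euler_dual :: "params \<Rightarrow> euler_state \<Rightarrow> euler_state" where
  "euler_dual P U = grad (euler_energy P) U"

text \<open>The pressure of the full system depends only on the Euler variables and coincides with the
  one below, see \<open>pressure_eq_euler_pressure\<close>.\<close>

definition euler_pressure :: "params \<Rightarrow> euler_state \<Rightarrow> real" where
  "euler_pressure P U = (\<Sum>c\<in>UNIV. U $ c * euler_dual P U $ c) - euler_energy P U"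

definition euler_flux :: "params \<Rightarrow> 3 \<Rightarrow> euler_state \<Rightarrow> euler_state" where
  "euler_flux P k U = (\<chi> c. case c of
       Rho \<Rightarrow> U $ Rho * (U $ Mom k / U $ Rho)
     | Mom i \<Rightarrow> U $ Rho * (U $ Mom i / U $ Rho) * (U $ Mom k / U $ Rho)
                + euler_pressure P U * (if i = k then 1 else 0)
     | Ent \<Rightarrow> U $ Ent * (U $ Mom k / U $ Rho))"

lemma partial_eqI:
  assumes "((\<lambda>h. f (x + h *\<^sub>R axis i 1)) has_real_derivative D) (at 0)"
  shows "partial i f x = D"
  using assms unfolding partial_def by (rule DERIV_imp_deriv)

lemma UNIV_euler_comp: "(UNIV :: euler_comp set) = insert Rho (insert Ent (range Mom))"
  by (auto intro: euler_comp.exhaust)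

lemma sum_euler_comp: "(\<Sum>c\<in>UNIV. f c) = f Rho + f Ent + (\<Sum>i\<in>UNIV. f (Mom i))"
proof -
  have "inj Mom" by (simp add: inj_on_def)
  moreover have "Ent \<notin> range Mom" "Rho \<notin> insert Ent (range Mom)" by auto
  ultimately show ?thesis
    unfolding UNIV_euler_comp by (simp add: sum.reindex add.assoc)
qed

lemma DERIV_euler_Rho:
  assumes "U $ Rho > 0"
  shows "((\<lambda>h. euler_energy P (U + h *\<^sub>R axis Rho 1)) has_real_derivative
    (gam P * U $ Rho powr (gam P - 1) - U $ Ent / c_v P * U $ Rho powr (gam P - 2)) / (gam P - 1)
        * exp (U $ Ent / U $ Rho / c_v P) - (\<Sum>i\<in>UNIV. (U $ Mom i / U $ Rho)\<^sup>2) / 2) (at 0)"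
proof -
  define R \<eta> g c K where defs: "R = U $ Rho" "\<eta> = U $ Ent" "g = gam P" "c = c_v P"
    "K = (\<Sum>i\<in>UNIV. (U $ Mom i)\<^sup>2)"
  have R: "R > 0" using assms by (simp add: defs)
  have s: "(\<Sum>i\<in>UNIV. (U $ Mom i / r)\<^sup>2) = K / r\<^sup>2" for r
    by (simp add: power_divide sum_divide_distrib defs)
  have r: "R powr g = R powr (g - 2) * R\<^sup>2"
    using R powr_add[of R "g - 2" 2] by simp
  have A: "((\<lambda>h. (R + h) powr g / (g - 1)) has_real_derivative g * R powr (g - 1) / (g - 1)) (at 0)"
  proof (rule DERIV_cdivide)
    have "((\<lambda>h. R + h) has_real_derivative 1) (at 0)"
      by (auto intro!: derivative_eq_intros)
    from DERIV_fun_powr[OF this, of g] R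
    show "((\<lambda>h. (R + h) powr g) has_real_derivative g * R powr (g - 1)) (at 0)" by simp
  qed
  have N: "((\<lambda>h. a / (R + h)) has_real_derivative - a / R\<^sup>2) (at 0)" for a
    using R by (auto intro!: derivative_eq_intros simp: power2_eq_square)
  have B: "((\<lambda>h. exp (\<eta> / (R + h) / c)) has_real_derivative exp (\<eta> / R / c) * (- \<eta> / R\<^sup>2 / c)) (at 0)"
    using DERIV_fun_exp[OF DERIV_cdivide[OF N[of \<eta>]], of c] by simp
  have C: "((\<lambda>h. K / 2 / (R + h)) has_real_derivative - (K / 2) / R\<^sup>2) (at 0)"
    by (rule N)
  have E: "euler_energy P (U + h *\<^sub>R axis Rho 1)
      = (R + h) powr g / (g - 1) * exp (\<eta> / (R + h) / c) + K / 2 / (R + h)" for h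
  proof -
    have "euler_energy P (U + h *\<^sub>R axis Rho 1)
      = (R + h) powr g / (g - 1) * exp (\<eta> / (R + h) / c)
        + 1/2 * (R + h) * (\<Sum>i\<in>UNIV. (U $ Mom i / (R + h))\<^sup>2)"
      by (simp add: euler_energy_def energy1_def energy2_def axis_def defs)
    moreover have "1/2 * (R + h) * (K / (R + h)\<^sup>2) = K / 2 / (R + h)"
      by (simp add: power2_eq_square)
    ultimately show ?thesis unfolding s by linarith
  qed
  have "g * R powr (g - 1) / (g - 1) * exp (\<eta> / R / c)
       + exp (\<eta> / R / c) * (- \<eta> / R\<^sup>2 / c) * (R powr g / (g - 1)) + - (K / 2) / R\<^sup>2
     = (g * R powr (g - 1) - \<eta> / c * R powr (g - 2)) / (g - 1) * exp (\<eta> / R / c) - K / R\<^sup>2 / 2"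
    unfolding r using R by (simp add: diff_divide_distrib left_diff_distrib right_diff_distrib mult_ac)
  with DERIV_add[OF DERIV_mult[OF A B] C] show ?thesis
    unfolding E s by (simp flip: defs)
qed

lemma DERIV_euler_Mom:
  assumes "U $ Rho > 0"
  shows "((\<lambda>h. euler_energy P (U + h *\<^sub>R axis (Mom i) 1)) has_real_derivative U $ Mom i / U $ Rho) (at 0)"
proof -
  have "((\<lambda>h. ((U + h *\<^sub>R axis (Mom i) 1) $ Mom j / U $ Rho)\<^sup>2) has_real_derivative
          (if j = i then 2 * U $ Mom i / (U $ Rho)\<^sup>2 else 0)) (at 0)" for j
  proof (cases "j = i")
    case True
    have "((\<lambda>h. ((U $ Mom i + h) / U $ Rho)\<^sup>2) has_real_derivative 2 * U $ Mom i / (U $ Rho)\<^sup>2) (at 0)"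
      using assms by (auto intro!: derivative_eq_intros simp: power2_eq_square)
    then show ?thesis using True by (simp add: axis_def)
  qed (simp add: axis_def)
  then have "((\<lambda>h. \<Sum>j\<in>UNIV. ((U + h *\<^sub>R axis (Mom i) 1) $ Mom j / U $ Rho)\<^sup>2)
      has_real_derivative (\<Sum>j\<in>UNIV. if j = i then 2 * U $ Mom i / (U $ Rho)\<^sup>2 else 0)) (at 0)"
    by (rule DERIV_sum)
  then have *: "((\<lambda>h. \<Sum>j\<in>UNIV. ((U + h *\<^sub>R axis (Mom i) 1) $ Mom j / U $ Rho)\<^sup>2)
      has_real_derivative 2 * U $ Mom i / (U $ Rho)\<^sup>2) (at 0)"
    by simp
  have "((\<lambda>h. energy1 P U + 1/2 * U $ Rho * (\<Sum>j\<in>UNIV. ((U + h *\<^sub>R axis (Mom i) 1) $ Mom j / U $ Rho)\<^sup>2))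
          has_real_derivative 0 + 1/2 * U $ Rho * (2 * U $ Mom i / (U $ Rho)\<^sup>2)) (at 0)"
    by (intro DERIV_add DERIV_const DERIV_cmult *)
  then show ?thesis
    using assms by (simp add: euler_energy_def energy1_def energy2_def axis_def power2_eq_square)
qed

lemma DERIV_euler_Ent:
  assumes "U $ Rho > 0"
  shows "((\<lambda>h. euler_energy P (U + h *\<^sub>R axis Ent 1)) has_real_derivative
    U $ Rho powr (gam P - 1) / ((gam P - 1) * c_v P) * exp (U $ Ent / U $ Rho / c_v P)) (at 0)"
proof -
  have r: "U $ Rho powr gam P = U $ Rho powr (gam P - 1) * U $ Rho"
    using assms powr_add[of "U $ Rho" "gam P - 1" 1] by simp
  have "((\<lambda>h. (U $ Ent + h) / U $ Rho / c_v P) has_real_derivative 1 / U $ Rho / c_v P) (at 0)"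
    by (intro DERIV_cdivide) (auto intro!: derivative_eq_intros)
  from DERIV_add[OF DERIV_cmult[OF DERIV_fun_exp[OF this], of "U $ Rho powr gam P / (gam P - 1)"]
      DERIV_const[of "energy2 U"]]
  have "((\<lambda>h. U $ Rho powr gam P / (gam P - 1) * exp ((U $ Ent + h) / U $ Rho / c_v P) + energy2 U)
      has_real_derivative U $ Rho powr (gam P - 1) / ((gam P - 1) * c_v P) * exp (U $ Ent / U $ Rho / c_v P)) (at 0)"
    using assms by (simp add: r mult_ac)
  then show ?thesis
    by (simp add: euler_energy_def energy1_def energy2_def axis_def)
qed

lemma euler_dual_Ent:
  assumes "U $ Rho > 0"
  shows "euler_dual P U $ Ent = U $ Rho powr (gam P - 1) / ((gam P - 1) * c_v P) * exp (U $ Ent / U $ Rho / c_v P)"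
  using partial_eqI[OF DERIV_euler_Ent[OF assms]] by (simp add: euler_dual_def grad_def)

lemma euler_dual_Mom:
  assumes "U $ Rho > 0"
  shows "euler_dual P U $ Mom i = U $ Mom i / U $ Rho"
  using partial_eqI[OF DERIV_euler_Mom[OF assms]] by (simp add: euler_dual_def grad_def)

lemma euler_dual_Rho:
  assumes "U $ Rho > 0" and "params_ok P"
  shows "euler_dual P U $ Rho = (gam P * c_v P - U $ Ent / U $ Rho) * euler_dual P U $ Ent
           - (\<Sum>i\<in>UNIV. (euler_dual P U $ Mom i)\<^sup>2) / 2"
proof -
  have r1: "U $ Rho powr (gam P - 1) = U $ Rho powr (gam P - 2) * U $ Rho"
    using assms by (simp add: powr_diff field_simps power2_eq_square)
  show ?thesis
    using partial_eqI[OF DERIV_euler_Rho[OF assms(1)]] assms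
    unfolding euler_dual_Ent[OF assms(1)] euler_dual_Mom[OF assms(1)]
    by (simp add: euler_dual_def grad_def r1 params_ok_def) (simp add: field_simps)
qed

lemma bij_betw_euler_dual:
  assumes P: "params_ok P"
  shows "bij_betw (euler_dual P) {U. U $ Rho > 0} {w. w $ Ent > 0}"
proof (rule bij_betw_imageI)
  have c: "gam P > 1" "c_v P > 0" using P by (auto simp: params_ok_def)
  show "inj_on (euler_dual P) {U. U $ Rho > 0}"
  proof (rule inj_onI, clarsimp)
    fix U V :: euler_state
    assume U: "0 < U $ Rho" and V: "0 < V $ Rho" and eq: "euler_dual P U = euler_dual P V"
    have T: "euler_dual P V $ Ent > 0" using V c by (simp add: euler_dual_Ent)
    have S: "U $ Ent / U $ Rho = V $ Ent / V $ Rho"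
      using euler_dual_Rho[OF U P] euler_dual_Rho[OF V P] T unfolding eq by simp
    have "U $ Rho powr (gam P - 1) = V $ Rho powr (gam P - 1)"
      using euler_dual_Ent[OF U, of P] euler_dual_Ent[OF V, of P] c unfolding eq S by simp
    then have "(U $ Rho powr (gam P - 1)) powr (1 / (gam P - 1)) = (V $ Rho powr (gam P - 1)) powr (1 / (gam P - 1))"
      by simp
    then have R: "U $ Rho = V $ Rho" using U V c by (simp add: powr_powr)
    have "U $ Mom i = V $ Mom i" for i
      using euler_dual_Mom[OF U, of P i] euler_dual_Mom[OF V, of P i] U unfolding eq R by simp
    moreover have "U $ Ent = V $ Ent" using S U R by simp
    ultimately show "U = V" using R unfolding vec_eq_iff by (metis euler_comp.exhaust)
  qed
  show "euler_dual P ` {U. U $ Rho > 0} = {w. w $ Ent > 0}"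
  proof (intro equalityI subsetI)
    fix w assume "w \<in> euler_dual P ` {U. U $ Rho > 0}"
    then show "w \<in> {w. w $ Ent > 0}" using c by (auto simp: euler_dual_Ent)
  next
    fix w :: euler_state assume "w \<in> {w. w $ Ent > 0}"
    then have w: "w $ Ent > 0" by simp
    define S where "S = gam P * c_v P - (w $ Rho + (\<Sum>i\<in>UNIV. (w $ Mom i)\<^sup>2) / 2) / w $ Ent"
    define r where "r = (w $ Ent * ((gam P - 1) * c_v P) / exp (S / c_v P)) powr (1 / (gam P - 1))"
    have r: "r > 0" using w c by (simp add: r_def)
    define U :: euler_state where "U = (\<chi> c. case c of Rho \<Rightarrow> r | Mom i \<Rightarrow> r * w $ Mom i | Ent \<Rightarrow> r * S)"
    have U [simp]: "U $ Rho = r" "\<And>i. U $ Mom i = r * w $ Mom i" "U $ Ent = r * S" by (simp_all add: U_def)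
    have Ur: "U $ Rho > 0" using r by simp
    have "r powr (gam P - 1) = w $ Ent * ((gam P - 1) * c_v P) / exp (S / c_v P)"
      using w c by (simp add: r_def powr_powr)
    then have E: "euler_dual P U $ Ent = w $ Ent"
      using r c by (simp add: euler_dual_Ent[OF Ur])
    have M: "euler_dual P U $ Mom i = w $ Mom i" for i
      using r by (simp add: euler_dual_Mom[OF Ur])
    have R: "euler_dual P U $ Rho = w $ Rho"
      using r w by (simp add: euler_dual_Rho[OF Ur P] E M) (simp add: S_def field_simps)
    have "euler_dual P U = w" using E M R unfolding vec_eq_iff by (metis euler_comp.exhaust)
    then show "w \<in> euler_dual P ` {U. U $ Rho > 0}" using Ur by auto
  qed
qed

lemma eul_add_axis: "eul (q + h *\<^sub>R axis (Eul c) 1) = eul q + h *\<^sub>R axis c 1"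
  by (simp add: eul_def vec_eq_iff axis_def)

lemma dual_Eul:
  assumes "dens q > 0"
  shows "dual P q $ Eul c = euler_dual P (eul q) $ c
           + (if c = Rho then spec_energy3 P q + spec_energy4 P q else 0)"
proof -
  have r: "eul q $ Rho > 0" using assms by (simp add: eul_def dens_def)
  obtain D where D: "((\<lambda>h. euler_energy P (eul q + h *\<^sub>R axis c 1)) has_real_derivative D) (at 0)"
    using DERIV_euler_Rho[OF r] DERIV_euler_Mom[OF r] DERIV_euler_Ent[OF r] by (cases c) blast+
  have A: "dist_mat (q + h *\<^sub>R axis (Eul c) 1) = dist_mat q"
          "(q + h *\<^sub>R axis (Eul c) 1) $ Thm i = q $ Thm i"
          "dens (q + h *\<^sub>R axis (Eul c) 1) = dens q + (if c = Rho then h else 0)" for h i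
    by (auto simp: dist_mat_def dens_def axis_def)
  have "((\<lambda>h. euler_energy P (eul q + h *\<^sub>R axis c 1)
             + (dens q + (if c = Rho then h else 0)) * (spec_energy3 P q + spec_energy4 P q))
          has_real_derivative D + (if c = Rho then spec_energy3 P q + spec_energy4 P q else 0)) (at 0)"
  proof (cases "c = Rho")
    case True
    have "((\<lambda>h. (dens q + h) * e) has_real_derivative e) (at 0)" for e
      by (auto intro!: derivative_eq_intros)
    from DERIV_add[OF D this] show ?thesis using True by simp
  next
    case False
    with DERIV_add[OF D DERIV_const] show ?thesis by simp
  qed
  moreover have "energy P (q + h *\<^sub>R axis (Eul c) 1) = euler_energy P (eul q + h *\<^sub>R axis c 1)
             + (dens q + (if c = Rho then h else 0)) * (spec_energy3 P q + spec_energy4 P q)" for h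
    using assms unfolding energy_def eul_add_axis energy3_def energy4_def A spec_energy3_def spec_energy4_def
    by (simp add: field_simps)
  ultimately have "((\<lambda>h. energy P (q + h *\<^sub>R axis (Eul c) 1))
          has_real_derivative D + (if c = Rho then spec_energy3 P q + spec_energy4 P q else 0)) (at 0)"
    by simp
  then show ?thesis
    using partial_eqI[OF D] by (simp add: dual_def euler_dual_def grad_def partial_eqI)
qed

lemma vel_eq_dual:
  assumes "dens q > 0"
  shows "vel q $ i = dual P q $ Eul (Mom i)"
  using assms by (simp add: dual_Eul euler_dual_Mom vel_def eul_def dens_def)

lemma temp_eq:
  assumes "dens q > 0"
  shows "temp P q = dens q powr (gam P - 1) / ((gam P - 1) * c_v P) * exp (q $ Eul Ent / dens q / c_v P)"
  using assms by (simp add: temp_def dual_Eul euler_dual_Ent eul_def dens_def)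

lemma pressure_eq_euler_pressure:
  assumes "dens q > 0"
  shows "pressure P q = euler_pressure P (eul q)"
  using assms
  by (simp add: pressure_def euler_pressure_def energy_def dual_Eul sum_euler_comp
      spec_energy3_def spec_energy4_def)
     (simp add: field_simps eul_def dens_def)

text \<open>The flux as a function of the dual variables; the inverse is meaningful by
  \<open>bij_betw_euler_dual\<close>.\<close>

definition euler_flux_dual :: "params \<Rightarrow> 3 \<Rightarrow> euler_state \<Rightarrow> euler_state" where
  "euler_flux_dual P k w = euler_flux P k (inv_into {U. U $ Rho > 0} (euler_dual P) w)"

definition num_flux :: "params \<Rightarrow> 3 \<Rightarrow> state \<Rightarrow> state \<Rightarrow> euler_state" where
  "num_flux P k ql qr =
     (let wl = euler_dual P (eul ql); wr = euler_dual P (eul qr)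
      in integral {0..1} (\<lambda>s. euler_flux_dual P k (wl + s *\<^sub>R (wr - wl))))"

definition D_flux :: "params \<Rightarrow> real^3 \<Rightarrow> state \<Rightarrow> state \<Rightarrow> euler_state" where
  "D_flux P n ql qr = (\<Sum>k\<in>UNIV. n $ k *\<^sub>R (num_flux P k ql qr - euler_flux P k (eul ql)))"


section \<open>Other face quantities\<close>

text \<open>Throughout, \<open>ql\<close> is the state of the cell under consideration, \<open>qr\<close> the state across the
  face, \<open>n\<close> the unit normal pointing from \<open>ql\<close> to \<open>qr\<close>.\<close>

definition visc_flux :: "real \<Rightarrow> real \<Rightarrow> state \<Rightarrow> state \<Rightarrow> state" where
  "visc_flux e d ql qr = (e / d) *\<^sub>R (qr - ql)"

definition A_face :: "state \<Rightarrow> state \<Rightarrow> real^3^3" where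
  "A_face ql qr = (1/2) *\<^sub>R (dist_mat ql + dist_mat qr)"

definition J_face :: "state \<Rightarrow> state \<Rightarrow> real^3" where
  "J_face ql qr = (1/2) *\<^sub>R (thermal ql + thermal qr)"

definition alpha_face :: "params \<Rightarrow> state \<Rightarrow> state \<Rightarrow> real^3^3" where
  "alpha_face P ql qr = (1/2) *\<^sub>R (alpha P ql + alpha P qr)"

definition beta_face :: "params \<Rightarrow> state \<Rightarrow> state \<Rightarrow> real^3" where
  "beta_face P ql qr = (1/2) *\<^sub>R (beta P ql + beta P qr)"

definition stress_face :: "params \<Rightarrow> state \<Rightarrow> state \<Rightarrow> real^3^3" where
  "stress_face P ql qr = (\<chi> j k. \<Sum>i\<in>UNIV. A_face ql qr $ i $ j * alpha_face P ql qr $ i $ k)"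

definition thermal_stress_face :: "params \<Rightarrow> state \<Rightarrow> state \<Rightarrow> real^3^3" where
  "thermal_stress_face P ql qr = (\<chi> j k. beta_face P ql qr $ k * J_face ql qr $ j)"

definition mass_flux :: "params \<Rightarrow> real^3 \<Rightarrow> state \<Rightarrow> state \<Rightarrow> real" where
  "mass_flux P n ql qr = (\<Sum>j\<in>UNIV. num_flux P j ql qr $ Rho * n $ j)"

text \<open>Arguments: normal mass flux, jump of the specific energy, denominator of the quotient, and
  normal average velocity as the fallback for a vanishing denominator.\<close>

definition u_tilde :: "real \<Rightarrow> real \<Rightarrow> real \<Rightarrow> real \<Rightarrow> real" where
  "u_tilde m jump denom u_avg =
     (if jump = 0 then 0 else if denom = 0 then u_avg else m * jump / denom)"

definition vel_avg :: "real^3 \<Rightarrow> state \<Rightarrow> state \<Rightarrow> real" where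
  "vel_avg n ql qr = (1/2) * (\<Sum>j\<in>UNIV. (vel ql $ j + vel qr $ j) * n $ j)"

definition uA :: "params \<Rightarrow> real^3 \<Rightarrow> state \<Rightarrow> state \<Rightarrow> real" where
  "uA P n ql qr = u_tilde (mass_flux P n ql qr) (spec_energy3 P qr - spec_energy3 P ql)
     (\<Sum>i\<in>UNIV. \<Sum>k\<in>UNIV. alpha_face P ql qr $ i $ k * (qr $ Dst i k - ql $ Dst i k))
     (vel_avg n ql qr)"

definition uJ :: "params \<Rightarrow> real^3 \<Rightarrow> state \<Rightarrow> state \<Rightarrow> real" where
  "uJ P n ql qr = u_tilde (mass_flux P n ql qr) (spec_energy4 P qr - spec_energy4 P ql)
     (\<Sum>k\<in>UNIV. beta_face P ql qr $ k * (qr $ Thm k - ql $ Thm k))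
     (vel_avg n ql qr)"

definition roe_matrix :: "params \<Rightarrow> state \<Rightarrow> state \<Rightarrow> real^comp^comp" where
  "roe_matrix P ql qr = integral {0..1} (\<lambda>s. hessian (energy P) (ql + s *\<^sub>R (qr - ql)))"

definition production :: "params \<Rightarrow> real \<Rightarrow> real \<Rightarrow> state \<Rightarrow> state \<Rightarrow> real" where
  "production P e d ql qr =
     1/2 * e * ((1 / temp P ql) *\<^sub>R (qr - ql) \<bullet> (roe_matrix P ql qr *v ((1 / d) *\<^sub>R (qr - ql))))"


section \<open>Mesh\<close>

text \<open>Control volumes of a Cartesian grid are labelled by pairs of integers; \<open>cells\<close> are the labels
  of those that make up the domain. A lattice neighbour of a cell that does not belong to \<open>cells\<close>
  labels the exterior side of a boundary edge.\<close>

type_synonym cell = "int \<times> int"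

record mesh =
  origin :: "real^2"
  dx :: real
  dy :: real
  cells :: "cell set"

definition mesh_ok :: "mesh \<Rightarrow> bool" where
  "mesh_ok M \<longleftrightarrow> dx M > 0 \<and> dy M > 0"

definition center :: "mesh \<Rightarrow> cell \<Rightarrow> real^2" where
  "center M l = origin M + vector [dx M * of_int (fst l), dy M * of_int (snd l)]"

definition volume :: "mesh \<Rightarrow> cell \<Rightarrow> (real^2) set" where
  "volume M l = cbox (center M l - vector [dx M / 2, dy M / 2]) (center M l + vector [dx M / 2, dy M / 2])"

definition area :: "mesh \<Rightarrow> cell \<Rightarrow> real" where
  "area M l = measure lborel (volume M l)"

definition nbrs :: "cell \<Rightarrow> cell set" where
  "nbrs l = {(fst l + 1, snd l), (fst l - 1, snd l), (fst l, snd l + 1), (fst l, snd l - 1)}"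

text \<open>The common edge is a line segment, so its length is its diameter.\<close>

definition edge_length :: "mesh \<Rightarrow> cell \<Rightarrow> cell \<Rightarrow> real" where
  "edge_length M l r = diameter (volume M l \<inter> volume M r)"

definition center_dist :: "mesh \<Rightarrow> cell \<Rightarrow> cell \<Rightarrow> real" where
  "center_dist M l r = norm (center M r - center M l)"

definition normal :: "mesh \<Rightarrow> cell \<Rightarrow> cell \<Rightarrow> real^3" where
  "normal M l r = (let n = (1 / center_dist M l r) *\<^sub>R (center M r - center M l)
                   in vector [n $ 1, n $ 2, 0])"

lemma area_eq:
  assumes "mesh_ok M"
  shows "area M l = dx M * dy M"
proof -
  have "cbox a b \<noteq> {} \<Longrightarrow> measure lborel (cbox a b) = (b $ 1 - a $ 1) * (b $ 2 - a $ 2)" for a b :: "real^2"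
    by (subst content_cbox_if_cart) (simp add: UNIV_2)
  then show ?thesis
    using assms by (simp add: area_def volume_def mesh_ok_def interval_ne_empty_cart forall_2)
qed

lemma center_diff:
  assumes "r \<in> nbrs l"
  obtains s where "\<bar>s\<bar> = 1" "center M r = center M l + vector [s * dx M, 0]"
        | s where "\<bar>s\<bar> = 1" "center M r = center M l + vector [0, s * dy M]"
proof -
  from assms consider "r = (fst l + 1, snd l)" | "r = (fst l - 1, snd l)"
    | "r = (fst l, snd l + 1)" | "r = (fst l, snd l - 1)"
    by (auto simp: nbrs_def)
  then show ?thesis
  proof cases
    case 1 then show ?thesis by (intro that(1)[of 1]) (auto simp: center_def vec_eq_iff forall_2 algebra_simps)
  next
    case 2 then show ?thesis by (intro that(1)[of "-1"]) (auto simp: center_def vec_eq_iff forall_2 algebra_simps)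
  next
    case 3 then show ?thesis by (intro that(2)[of 1]) (auto simp: center_def vec_eq_iff forall_2 algebra_simps)
  next
    case 4 then show ?thesis by (intro that(2)[of "-1"]) (auto simp: center_def vec_eq_iff forall_2 algebra_simps)
  qed
qed

lemma norm_real_2: "norm (x :: real^2) = sqrt ((x $ 1)\<^sup>2 + (x $ 2)\<^sup>2)"
  by (simp add: norm_vec_def L2_set_def sum_2)

lemma center_dist_eq:
  assumes "mesh_ok M" and "r \<in> nbrs l"
  shows "center_dist M l r = dx M * \<bar>normal M l r $ 1\<bar> + dy M * \<bar>normal M l r $ 2\<bar>"
proof -
  have d: "dx M > 0" "dy M > 0" using assms(1) by (auto simp: mesh_ok_def)
  show ?thesis
    using d by (cases rule: center_diff[OF assms(2), of M])
      (simp_all add: normal_def Let_def center_dist_def norm_real_2 abs_mult)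
qed

lemma edge_length_eq:
  assumes "mesh_ok M" and "r \<in> nbrs l"
  shows "edge_length M l r = dy M * \<bar>normal M l r $ 1\<bar> + dx M * \<bar>normal M l r $ 2\<bar>"
proof -
  have d: "dx M > 0" "dy M > 0" using assms(1) by (auto simp: mesh_ok_def)
  have dia: "diameter {a..b} = norm (b - a)" if "a $ 1 \<le> b $ 1" "a $ 2 \<le> b $ 2" for a b :: "real^2"
    using diameter_cbox[of a b] that
    by (auto simp: Basis_vec_def inner_axis UNIV_2 dist_norm norm_minus_commute interval_cbox_cart)
  have s: "s = 1 \<or> s = -1" if "\<bar>s\<bar> = 1" for s :: real using that by linarith
  show ?thesis
  proof (cases rule: center_diff[OF assms(2), of M])
    case (1 s)
    from s[OF 1(1)] 1(2) d show ?thesis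
      by (elim disjE) (simp_all add: edge_length_def volume_def Int_interval_cart dia normal_def Let_def
       center_dist_def norm_real_2 max_def min_def abs_mult)
  next
    case (2 s)
    from s[OF 2(1)] 2(2) d show ?thesis
      by (elim disjE) (simp_all add: edge_length_def volume_def Int_interval_cart dia normal_def Let_def
       center_dist_def norm_real_2 max_def min_def abs_mult)
  qed
qed

definition face_avg :: "mesh \<Rightarrow> cell \<Rightarrow> (cell \<Rightarrow> real) \<Rightarrow> real" where
  "face_avg M l X = 1 / area M l * (\<Sum>r\<in>nbrs l. edge_length M l r * X r)"


section \<open>The semi-discrete scheme\<close>

text \<open>\<open>q t l\<close> is the state of cell \<open>l\<close> at time \<open>t\<close>, \<open>qb t l r\<close> the boundary state carried by the
  exterior side \<open>r\<close> of a boundary edge of \<open>l\<close>, \<open>eps t l r\<close> the numerical viscosity.\<close>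

definition nbr_state ::
  "mesh \<Rightarrow> (real \<Rightarrow> cell \<Rightarrow> state) \<Rightarrow> (real \<Rightarrow> cell \<Rightarrow> cell \<Rightarrow> state) \<Rightarrow> real \<Rightarrow> cell \<Rightarrow> cell \<Rightarrow> state" where
  "nbr_state M q qb t l r = (if r \<in> cells M then q t r else qb t l r)"

definition viscosity_ok :: "mesh \<Rightarrow> real set \<Rightarrow> (real \<Rightarrow> cell \<Rightarrow> cell \<Rightarrow> real) \<Rightarrow> bool" where
  "viscosity_ok M I eps \<longleftrightarrow>
     (\<forall>t\<in>I. \<forall>l\<in>cells M. \<forall>r\<in>nbrs l. eps t l r = eps t r l \<and> 0 \<le> eps t l r)"

definition is_solution ::
  "params \<Rightarrow> mesh \<Rightarrow> (real \<Rightarrow> cell \<Rightarrow> cell \<Rightarrow> real) \<Rightarrow> real set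
     \<Rightarrow> (real \<Rightarrow> cell \<Rightarrow> state) \<Rightarrow> (real \<Rightarrow> cell \<Rightarrow> cell \<Rightarrow> state) \<Rightarrow> bool" where
  "is_solution P M eps I q qb \<longleftrightarrow> (\<forall>t\<in>I. \<forall>l\<in>cells M.
     let ql = q t l; qr = nbr_state M q qb t l; n = normal M l;
         D = (\<lambda>r. D_flux P (n r) ql (qr r));
         g = (\<lambda>r. visc_flux (eps t l r) (center_dist M l r) ql (qr r));
         avg = face_avg M l;
         th1 = theta1 P ql; th2 = theta2 P ql; T = temp P ql
     in admissible ql \<and> (\<forall>r\<in>nbrs l. admissible (qr r))
      \<and> ((\<lambda>t. q t l $ Eul Rho) has_real_derivative
           - avg (\<lambda>r. D r $ Rho) + avg (\<lambda>r. g r $ Eul Rho)) (at t within I)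
      \<and> (\<forall>i. ((\<lambda>t. q t l $ Eul (Mom i)) has_real_derivative
           - avg (\<lambda>r. D r $ Mom i)
           - avg (\<lambda>r. \<Sum>k\<in>UNIV. (stress_face P ql (qr r) $ i $ k - stress P ql $ i $ k) * n r $ k)
           - avg (\<lambda>r. \<Sum>k\<in>UNIV. (thermal_stress_face P ql (qr r) $ i $ k - thermal_stress P ql $ i $ k) * n r $ k)
           + avg (\<lambda>r. g r $ Eul (Mom i))) (at t within I))
      \<and> ((\<lambda>t. q t l $ Eul Ent) has_real_derivative
           - avg (\<lambda>r. D r $ Ent)
           - avg (\<lambda>r. \<Sum>k\<in>UNIV. (beta_face P ql (qr r) $ k - beta P ql $ k) * n r $ k)
           + avg (\<lambda>r. g r $ Eul Ent)
           + avg (\<lambda>r. production P (eps t l r) (center_dist M l r) ql (qr r))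
           + (\<Sum>i\<in>UNIV. \<Sum>k\<in>UNIV. alpha P ql $ i $ k * alpha P ql $ i $ k) / (th1 * T)
           + (\<Sum>i\<in>UNIV. beta P ql $ i * beta P ql $ i) / (th2 * T)) (at t within I)
      \<and> (\<forall>i k. ((\<lambda>t. q t l $ Dst i k) has_real_derivative
           - avg (\<lambda>r. \<Sum>m\<in>UNIV. 1/2 * A_face ql (qr r) $ i $ m * (vel (qr r) $ m - vel ql $ m) * n r $ k)
           - avg (\<lambda>r. 1/2 * uA P (n r) ql (qr r) * (qr r $ Dst i k - ql $ Dst i k))
           + avg (\<lambda>r. g r $ Dst i k)
           - alpha P ql $ i $ k / th1) (at t within I))
      \<and> (\<forall>k. ((\<lambda>t. q t l $ Thm k) has_real_derivative
           - avg (\<lambda>r. \<Sum>m\<in>UNIV. 1/2 * J_face ql (qr r) $ m * (vel (qr r) $ m - vel ql $ m) * n r $ k)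
           - avg (\<lambda>r. 1/2 * (temp P (qr r) - T) * n r $ k)
           - avg (\<lambda>r. 1/2 * uJ P (n r) ql (qr r) * (qr r $ Thm k - ql $ Thm k))
           + avg (\<lambda>r. g r $ Thm k)
           - beta P ql $ k / th2) (at t within I)))"

end

theory Submission
  imports Defs
begin

text \<open>The entropy balance is itself one of the evolution equations of the scheme. Moving the
  Euler, heat and viscous face terms to the left leaves the averaged production and the two
  relaxation sources. The production is a nonnegative multiple of the quadratic form of the Roe
  matrix at the state jump (\<open>production_nonneg\<close>), and face averages preserve sign
  (\<open>face_avg_nonneg\<close>). The sources are squared norms of \<alpha> and \<beta> divided by
  positive factors (\<open>theta1_pos\<close>, \<open>theta2_pos\<close> and T > 0).\<close>

text \<open>Makes derivatives within \<open>I\<close> unique, also at an endpoint: a connected set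
  with more than one point has no isolated points.\<close>

lemma at_within_interval_neq_bot:
  fixes I :: "real set"
  assumes "is_interval I" and "interior I \<noteq> {}" and "t \<in> I"
  shows "at t within I \<noteq> bot"
proof -
  have "I \<noteq> {t}" using assms(2) by auto
  then have "t islimpt I"
    using connected_imp_perfect is_interval_connected assms by blast
  then show ?thesis by (simp add: trivial_limit_within)
qed

lemma face_avg_eq_sum:
  "face_avg M l X = (\<Sum>r\<in>nbrs l. edge_length M l r / area M l * X r)"
  by (simp add: face_avg_def sum_distrib_left)

text \<open>The weights are nonnegative, being a diameter of a bounded set over a measure.\<close>

lemma face_avg_nonneg:
  assumes "\<And>r. r \<in> nbrs l \<Longrightarrow> 0 \<le> X r"
  shows "0 \<le> face_avg M l X"
proof -
  have "0 \<le> edge_length M l r" for r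
    unfolding edge_length_def volume_def by (intro diameter_ge_0 bounded_Int) simp
  then show ?thesis
    using assms by (simp add: face_avg_def area_def sum_nonneg)
qed

lemma theta1_pos:
  assumes "params_ok P" and "admissible q"
  shows "0 < theta1 P q"
  using assms by (simp add: theta1_def params_ok_def admissible_def)

lemma theta2_pos:
  assumes "params_ok P" and "admissible q" and "0 < temp P q"
  shows "0 < theta2 P q"
  using assms by (simp add: theta2_def params_ok_def admissible_def)

text \<open>The scalars 1/T and 1/d factor out of the quadratic form. The case d = 0 is harmless,
  since then 1/d = 0.\<close>

lemma production_nonneg:
  assumes "0 \<le> e" and "0 \<le> d" and "0 < temp P ql"
    and "pos_semidef (roe_matrix P ql qr)"
  shows "0 \<le> production P e d ql qr"
proof -
  let ?x = "qr - ql"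
  have "0 \<le> ?x \<bullet> (roe_matrix P ql qr *v ?x)"
    using assms(4) by (simp add: pos_semidef_def)
  then show ?thesis
    using assms(1-3) by (simp add: production_def matrix_vector_mult_scaleR)
qed

theorem theorem2:
  fixes P :: params and M :: mesh and I :: "real set"
    and eps :: "real \<Rightarrow> cell \<Rightarrow> cell \<Rightarrow> real"
    and q :: "real \<Rightarrow> cell \<Rightarrow> state" and qb :: "real \<Rightarrow> cell \<Rightarrow> cell \<Rightarrow> state"
    and l :: cell and t :: real
  defines "qr \<equiv> nbr_state M q qb t l"
  assumes "params_ok P" and "mesh_ok M" and "is_interval I" and "interior I \<noteq> {}"
    and "viscosity_ok M I eps"
    and "is_solution P M eps I q qb"
    and "l \<in> cells M" and "t \<in> I"
    and "temp P (q t l) > 0"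
    and "\<forall>r\<in>nbrs l. pos_semidef (roe_matrix P (q t l) (qr r))"
  shows "vector_derivative (\<lambda>t. q t l $ Eul Ent) (at t within I)
      + (\<Sum>r\<in>nbrs l. edge_length M l r / area M l * D_flux P (normal M l r) (q t l) (qr r) $ Ent)
      + (\<Sum>r\<in>nbrs l. edge_length M l r / area M l *
           (\<Sum>k\<in>UNIV. (beta_face P (q t l) (qr r) $ k - beta P (q t l) $ k) * normal M l r $ k))
      - (\<Sum>r\<in>nbrs l. edge_length M l r / area M l *
           visc_flux (eps t l r) (center_dist M l r) (q t l) (qr r) $ Eul Ent) \<ge> 0"
proof -
  let ?ql = "q t l" and ?n = "normal M l"
  let ?prod = "face_avg M l (\<lambda>r. production P (eps t l r) (center_dist M l r) ?ql (qr r))"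
  let ?src1 = "(\<Sum>i\<in>UNIV. \<Sum>k\<in>UNIV. alpha P ?ql $ i $ k * alpha P ?ql $ i $ k)
                 / (theta1 P ?ql * temp P ?ql)"
  let ?src2 = "(\<Sum>i\<in>UNIV. beta P ?ql $ i * beta P ?ql $ i) / (theta2 P ?ql * temp P ?ql)"
  from \<open>is_solution P M eps I q qb\<close> \<open>l \<in> cells M\<close> \<open>t \<in> I\<close>
  have adm: "admissible ?ql"
    and deriv: "((\<lambda>t. q t l $ Eul Ent) has_real_derivative
           - face_avg M l (\<lambda>r. D_flux P (?n r) ?ql (qr r) $ Ent)
           - face_avg M l (\<lambda>r. \<Sum>k\<in>UNIV. (beta_face P ?ql (qr r) $ k - beta P ?ql $ k) * ?n r $ k)
           + face_avg M l (\<lambda>r. visc_flux (eps t l r) (center_dist M l r) ?ql (qr r) $ Eul Ent)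
           + ?prod + ?src1 + ?src2) (at t within I)"
    by (auto simp: is_solution_def Let_def qr_def)
  have "0 \<le> eps t l r" if "r \<in> nbrs l" for r
    using that assms by (auto simp: viscosity_ok_def)
  then have "0 \<le> ?prod"
    using assms by (intro face_avg_nonneg production_nonneg) (auto simp: center_dist_def)
  moreover have "0 \<le> ?src1" "0 \<le> ?src2"
    using theta1_pos[OF \<open>params_ok P\<close> adm] theta2_pos[OF \<open>params_ok P\<close> adm] \<open>temp P ?ql > 0\<close>
    by (simp_all add: sum_nonneg)
  \<comment> \<open>Uniqueness identifies \<open>vector_derivative\<close> with the right-hand side
    of the entropy equation.\<close>
  moreover note vector_derivative_within
    [OF at_within_interval_neq_bot[OF \<open>is_interval I\<close> \<open>interior I \<noteq> {}\<close> \<open>t \<in> I\<close>]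
      deriv[unfolded has_real_derivative_iff_has_vector_derivative]]
  \<comment> \<open>Folding the weighted sums back into \<open>face_avg\<close> lets the three flux
    terms cancel as atoms.\<close>
  ultimately show ?thesis unfolding face_avg_eq_sum[symmetric] by linarith
qed

end
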